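(* Let $d>1$ and suppose $p,q$ are product distributions on $\mathbb{R}^d$ of the form \[p(z)\propto\prod_{i=1}^d g(z_i)^{r_p},\qquad q(z)\propto\prod_{i=1}^d g(z_i)^{r_q},\] where $r_p,r_q>0$, $r_p\neq r_q$, and $g$ is a smooth function. If a flow $f$ composed of finitely many ReLU Sylvester flows on $\mathbb{R}^d$ satisfies $p=f\#q$, then almost every point $x\in\mathbb{R}^d$ has an open neighbourhood $\Gamma_x$ such that for all $z\in\Gamma_x$, \[r_q\,\tilde{\nabla}\log\mathbf{g}(z)=r_p\,A^{\top}\,\tilde{\nabla}\log\mathbf{g}(Az+b)\] holds for some $A\in\mathbb{R}^{d\times d}$ and $b\in\mathbb{R}^d$ (not depending on $z\in\Gamma_x$).
   Context: Here $\mathbf{g}(z)=(g(z_1),\dots,g(z_d))^{\top}$ and $\tilde\nabla$ takes the gradient of the $i$-th function with respect to the $i$-th variable for $1\le i\le d$, so $\tilde\nabla\log\mathbf{g}(y)=\left(g'(y_1)/g(y_1),\dots,g'(y_d)/g(y_d)\right)^{\top}$. A normalizing flow on $\mathbb{R}^d$ is an invertible function $f:\mathbb{R}^d\to\mathbb{R}^d$ that is differentiable almost everywhere with $\det J_f(z)\neq0$ for almost every $z$, where $J_f$ is the Jacobian matrix. If $z$ has density $q$, then $f\#q$ denotes the density of $f(z)$, given by $(f\#q)(f(z))=q(z)/|\det J_f(z)|$; equality of densities is almost everywhere. A ReLU Sylvester flow on $\mathbb{R}^d$ is a normalizing flow of the form $f(z)=z+A_0\,\mathrm{ReLU}(B_0^{\top}z+b_0)$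 with $m<d$, $A_0,B_0\in\mathbb{R}^{d\times m}$, $b_0\in\mathbb{R}^m$, where $\mathrm{ReLU}(x)=\max(x,0)$ is applied coordinate-wise. *)

theory Defs
  imports "HOL-Analysis.Analysis"
begin

definition smooth :: "(real \<Rightarrow> real) \<Rightarrow> bool" where
  "smooth g \<longleftrightarrow> (\<forall>k x. ((deriv ^^ k) g) differentiable (at x))"

definition normalizing_flow :: "(real^'d \<Rightarrow> real^'d) \<Rightarrow> bool" where
  "normalizing_flow f \<longleftrightarrow> bij f \<and>
     (AE z in lborel. f differentiable (at z)) \<and>
     (AE z in lborel. det (jacobian f (at z)) \<noteq> 0)"

definition ReLU :: "real \<Rightarrow> real" where
  "ReLU x = max x 0"

text \<open>The width \<open>m\<close> is existentially quantified and varies from layer to layer, so it cannot be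
  a type: \<open>A j\<close> and \<open>B j\<close> are the \<open>j\<close>-th columns, \<open>j < m\<close>, of the \<open>d \<times> m\<close> matrices \<open>A\<^sub>0\<close> and \<open>B\<^sub>0\<close>,
  and \<open>b j\<close> is the \<open>j\<close>-th entry of \<open>b\<^sub>0\<close>. Hence \<open>B j \<bullet> z\<close> is the \<open>j\<close>-th entry of \<open>B\<^sub>0\<^sup>T z\<close>, and
  the sum is \<open>A\<^sub>0 ReLU(B\<^sub>0\<^sup>T z + b\<^sub>0)\<close>.\<close>
definition relu_sylvester_flow :: "(real^'d \<Rightarrow> real^'d) \<Rightarrow> bool" where
  "relu_sylvester_flow f \<longleftrightarrow> normalizing_flow f \<and>
     (\<exists>m < CARD('d). \<exists>(A :: nat \<Rightarrow> real^'d) (B :: nat \<Rightarrow> real^'d) (b :: nat \<Rightarrow> real).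
        \<forall>z. f z = z + (\<Sum>j<m. ReLU (B j \<bullet> z + b j) *\<^sub>R A j))"

definition prob_density :: "(real^'d \<Rightarrow> real) \<Rightarrow> bool" where
  "prob_density p \<longleftrightarrow> (\<forall>z. 0 \<le> p z) \<and> has_bochner_integral lborel p 1"

text \<open>Densities are only determined almost everywhere, so the proportionality is as well.\<close>
definition product_power_density :: "(real \<Rightarrow> real) \<Rightarrow> real \<Rightarrow> (real^'d \<Rightarrow> real) \<Rightarrow> bool" where
  "product_power_density g r p \<longleftrightarrow> prob_density p \<and>
     (\<exists>c>0. AE z in lborel. p z = c * (\<Prod>i\<in>UNIV. g (z $ i) powr r))"

text \<open>The density of the image of \<open>q\<close> under a flow \<open>f\<close>, by the change of variables formula.
  It is only meant almost everywhere: where \<open>f\<close> is not differentiable its value is arbitrary.\<close>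
definition pushforward_density ::
    "(real^'d \<Rightarrow> real^'d) \<Rightarrow> (real^'d \<Rightarrow> real) \<Rightarrow> real^'d \<Rightarrow> real" where
  "pushforward_density f q y = q (inv f y) / \<bar>det (jacobian f (at (inv f y)))\<bar>"

definition tilde_nabla :: "('d \<Rightarrow> real \<Rightarrow> real) \<Rightarrow> real^'d \<Rightarrow> real^'d" where
  "tilde_nabla h y = (\<chi> i. deriv (h i) (y $ i))"

definition tilde_nabla_log :: "(real \<Rightarrow> real) \<Rightarrow> real^'d \<Rightarrow> real^'d" where
  "tilde_nabla_log g = tilde_nabla (\<lambda>i t. ln (g t))"

lemma tilde_nabla_log_eq:
  assumes "smooth g" and "\<And>t. g t > 0"
  shows "tilde_nabla_log g y = (\<chi> i. deriv g (y $ i) / g (y $ i))"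
proof -
  have "deriv (\<lambda>t. ln (g t)) t = deriv g t / g t" for t
  proof -
    have "g differentiable (at t)"
      using assms(1) unfolding smooth_def by (metis funpow_0)
    then have "(g has_real_derivative deriv g t) (at t)"
      by (simp add: DERIV_deriv_iff_real_differentiable)
    from DERIV_chain2[OF DERIV_ln[OF assms(2)] this]
    have "((\<lambda>t. ln (g t)) has_real_derivative inverse (g t) * deriv g t) (at t)" .
    then show ?thesis
      by (simp add: DERIV_imp_deriv divide_inverse mult.commute)
  qed
  then show ?thesis
    by (simp add: tilde_nabla_log_def tilde_nabla_def)
qed

end

theory Submission
  imports Defs
begin

text \<open>
  A ReLU Sylvester flow is affine, with invertible linear part, near every point off finitely many
  hyperplanes, up to a null set. Preimages of null sets under maps with this property are null, so
  the property passes to compositions. Near such a point \<open>det J\<^sub>f\<close> is constant, so taking logarithms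
  of \<open>p(f z) \<bar>det J\<^sub>f(z)\<bar> = q(z)\<close> gives
  \<open>r_p \<Sum>\<^sub>i ln g((Az + b)\<^sub>i) + const = r_q \<Sum>\<^sub>i ln g(z\<^sub>i)\<close> almost everywhere, hence by continuity
  everywhere on the neighbourhood. Differentiation in \<open>z\<close> yields the claim.
\<close>

section \<open>Null sets and almost everywhere statements\<close>

lemma AE_lborel_iff_negligible:
  fixes P :: "'a::euclidean_space \<Rightarrow> bool"
  shows "(AE x in lborel. P x) \<longleftrightarrow> negligible {x. \<not> P x}"
proof -
  have "(AE x in lborel. P x) \<longleftrightarrow> (AE x in lebesgue. P x)"
    by (simp add: AE_completion_iff)
  also have "\<dots> \<longleftrightarrow> negligible {x. \<not> P x}"
  proof
    assume "AE x in lebesgue. P x"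
    then obtain N where "N \<in> null_sets lebesgue" "{x. \<not> P x} \<subseteq> N"
      by (auto simp: eventually_ae_filter)
    then show "negligible {x. \<not> P x}"
      using negligible_iff_null_sets negligible_subset by blast
  next
    assume "negligible {x. \<not> P x}"
    then have "{x. \<not> P x} \<in> null_sets lebesgue"
      by (simp add: negligible_iff_null_sets)
    then show "AE x in lebesgue. P x"
      by (rule AE_I') simp
  qed
  finally show ?thesis .
qed

text \<open>The points of \<open>S\<close> where the functions differ form an open null set, and a
  nonempty open set has positive measure.\<close>

lemma continuous_on_AE_eq:
  fixes u v :: "'a::euclidean_space \<Rightarrow> real"
  assumes "open S" "continuous_on S u" "continuous_on S v"
    and ae: "AE x in lborel. x \<in> S \<longrightarrow> u x = v x"
    and "x \<in> S"
  shows "u x = v x"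
proof (rule ccontr)
  assume "u x \<noteq> v x"
  define T where "T = S \<inter> (\<lambda>x. u x - v x) -` (- {0})"
  have "open T"
    unfolding T_def
    by (intro continuous_open_preimage continuous_on_diff assms) auto
  moreover have "x \<in> T"
    using \<open>u x \<noteq> v x\<close> \<open>x \<in> S\<close> by (simp add: T_def)
  moreover have "negligible T"
    using ae unfolding AE_lborel_iff_negligible
    by (rule negligible_subset) (auto simp: T_def)
  ultimately show False
    using open_not_negligible by blast
qed

section \<open>Locally affine maps and their compositions\<close>

definition locally_invertible_affine :: "(real^'d \<Rightarrow> real^'d) \<Rightarrow> real^'d \<Rightarrow> bool" where
  "locally_invertible_affine f x \<longleftrightarrow>
     (\<exists>A b. det A \<noteq> 0 \<and> (\<forall>\<^sub>F z in nhds x. f z = A *v z + b))"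

lemma has_derivative_affine:
  fixes A :: "real^'n^'m"
  shows "((\<lambda>z. A *v z + b) has_derivative (*v) A) (at x)"
  using bounded_linear_imp_has_derivative[OF matrix_vector_mul_bounded_linear]
  by (rule has_derivative_add_const)

lemma jacobian_eventually_affine:
  fixes f :: "real^'n \<Rightarrow> real^'m"
  assumes "\<forall>\<^sub>F z in nhds x. f z = A *v z + b"
  shows "jacobian f (at x) = A"
proof -
  obtain S where "open S" "x \<in> S" "\<And>z. z \<in> S \<Longrightarrow> f z = A *v z + b"
    using assms unfolding eventually_nhds by blast
  then have "(f has_derivative (*v) A) (at x)"
    by (intro has_derivative_transform_within_open[OF has_derivative_affine, of S]) auto
  then show ?thesis
    unfolding jacobian_def by (metis frechet_derivative_at matrix_of_matrix_vector_mul)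
qed

text \<open>The preimage is contained in the image of \<open>N\<close> under the inverse affine map,
  and differentiable maps send null sets to null sets.\<close>

lemma negligible_vimage_affine:
  fixes A :: "real^'n^'n"
  assumes "det A \<noteq> 0" "negligible N"
  shows "negligible ((\<lambda>z. A *v z + b) -` N)"
proof -
  obtain A' where A': "A' ** A = mat 1"
    using assms(1) invertible_det_nz invertible_def by metis
  have "negligible ((\<lambda>y. A' *v (y - b)) ` N)"
  proof (rule negligible_differentiable_image_negligible[OF order_refl assms(2)])
    have "(\<lambda>y. A' *v (y - b)) = (\<lambda>y. A' *v y + A' *v (- b))"
      by (simp flip: matrix_vector_right_distrib)
    then show "(\<lambda>y. A' *v (y - b)) differentiable_on N"
      unfolding differentiable_on_def
      by (auto intro: differentiableI has_derivative_at_withinI has_derivative_affine)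
  qed
  moreover have "(\<lambda>z. A *v z + b) -` N \<subseteq> (\<lambda>y. A' *v (y - b)) ` N"
  proof
    fix z assume "z \<in> (\<lambda>z. A *v z + b) -` N"
    then have "A *v z + b \<in> N" "z = A' *v ((A *v z + b) - b)"
      using A' by (auto simp: matrix_vector_mul_assoc)
    then show "z \<in> (\<lambda>y. A' *v (y - b)) ` N" by blast
  qed
  ultimately show ?thesis by (rule negligible_subset)
qed

text \<open>This transfers null sets backwards along \<open>f\<close>. Near each point the
  exceptional set lies in the preimage of a null set under one invertible affine map; the affine map
  changes from point to point, but a locally negligible set is negligible.\<close>

lemma AE_compose_locally_invertible_affine:
  assumes f: "AE x in lborel. locally_invertible_affine f x"
    and P: "AE y in lborel. P y"
  shows "AE x in lborel. P (f x)"
proof -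
  define S where "S = {x. locally_invertible_affine f x \<and> \<not> P (f x)}"
  have "\<exists>U. openin (top_of_set S) U \<and> x \<in> U \<and> negligible U" if "x \<in> S" for x
  proof -
    obtain A b where "det A \<noteq> 0" "\<forall>\<^sub>F z in nhds x. f z = A *v z + b"
      using \<open>x \<in> S\<close> unfolding S_def locally_invertible_affine_def by auto
    then obtain G where G: "open G" "x \<in> G" "\<And>z. z \<in> G \<Longrightarrow> f z = A *v z + b"
      unfolding eventually_nhds by blast
    have "negligible ((\<lambda>z. A *v z + b) -` {y. \<not> P y})"
      using negligible_vimage_affine[OF \<open>det A \<noteq> 0\<close>] P by (simp only: AE_lborel_iff_negligible)
    moreover have "S \<inter> G \<subseteq> (\<lambda>z. A *v z + b) -` {y. \<not> P y}"
      using G(3) by (auto simp: S_def)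
    ultimately have "negligible (S \<inter> G)" by (rule negligible_subset)
    then show ?thesis using G \<open>x \<in> S\<close> by blast
  qed
  then have "negligible S" by (subst locally_negligible_alt) blast
  then have "AE x in lborel. x \<notin> S" by (simp add: AE_lborel_iff_negligible)
  with f show ?thesis by eventually_elim (auto simp: S_def)
qed

lemma locally_invertible_affine_compose:
  assumes "locally_invertible_affine f (h x)" "locally_invertible_affine h x"
  shows "locally_invertible_affine (f \<circ> h) x"
proof -
  obtain A b where A: "det A \<noteq> 0" "\<forall>\<^sub>F y in nhds (h x). f y = A *v y + b"
    using assms(1) unfolding locally_invertible_affine_def by auto
  obtain C c where C: "det C \<noteq> 0" "\<forall>\<^sub>F z in nhds x. h z = C *v z + c"
    using assms(2) unfolding locally_invertible_affine_def by auto
  \<comment> \<open>Continuity of the inner affine map pulls the formula for \<open>f\<close> near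
    \<open>h x\<close> back to a neighbourhood of \<open>x\<close>.\<close>
  have "((\<lambda>z. C *v z + c) \<longlongrightarrow> C *v x + c) (nhds x)"
    using has_derivative_continuous[OF has_derivative_affine[of C c x]]
      tendsto_at_iff_tendsto_nhds[of "\<lambda>z. C *v z + c" x]
    by (simp only: continuous_at)
  \<comment> \<open>The filter \<open>nhds x\<close> includes \<open>x\<close> itself, so the limit
    really is \<open>h x\<close>.\<close>
  moreover have "h x = C *v x + c"
    using C(2) eventually_nhds_x_imp_x by blast
  ultimately have "\<forall>\<^sub>F z in nhds x. f (C *v z + c) = A *v (C *v z + c) + b"
    using A(2) by (auto simp: filterlim_iff)
  with C(2) have "\<forall>\<^sub>F z in nhds x. (f \<circ> h) z = (A ** C) *v z + (A *v c + b)"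
    by eventually_elim
      (simp add: matrix_vector_right_distrib matrix_vector_mul_assoc add.assoc)
  moreover have "det (A ** C) \<noteq> 0" using A C by (simp add: det_mul)
  ultimately show ?thesis unfolding locally_invertible_affine_def by blast
qed

section \<open>ReLU Sylvester flows are locally affine almost everywhere\<close>

lemma relu_sylvester_flow_bij: "relu_sylvester_flow h \<Longrightarrow> bij h"
  by (simp add: relu_sylvester_flow_def normalizing_flow_def)

text \<open>Off the hyperplane the sign of the affine form is locally constant. For
  \<open>B = 0\<close> there is no hyperplane to avoid: the form is the constant \<open>b\<close>,
  even if \<open>b = 0\<close>.\<close>

lemma eventually_ReLU_affine:
  fixes B :: "'a::real_inner"
  assumes "B \<noteq> 0 \<Longrightarrow> B \<bullet> x + b \<noteq> 0"
  shows "\<forall>\<^sub>F z in nhds x. ReLU (B \<bullet> z + b) = (if B \<bullet> x + b > 0 then B \<bullet> z + b else 0)"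
proof (cases "B = 0")
  case True
  then show ?thesis by (auto simp: ReLU_def)
next
  case False
  have lim: "((\<lambda>z. B \<bullet> z + b) \<longlongrightarrow> B \<bullet> x + b) (nhds x)"
    by (intro tendsto_intros) (auto simp: filterlim_def)
  show ?thesis
  proof (cases "B \<bullet> x + b > 0")
    case True
    from order_tendstoD(1)[OF lim True] show ?thesis
      by eventually_elim (use True in \<open>simp add: ReLU_def\<close>)
  next
    case False
    with assms \<open>B \<noteq> 0\<close> have "B \<bullet> x + b < 0" by force
    from order_tendstoD(2)[OF lim this] show ?thesis
      by eventually_elim (use False in \<open>simp add: ReLU_def\<close>)
  qed
qed

lemma relu_sylvester_flow_AE_locally_invertible_affine:
  fixes h :: "real^'d \<Rightarrow> real^'d"
  assumes "relu_sylvester_flow h"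
  shows "AE x in lborel. locally_invertible_affine h x"
proof -
  obtain m and A B :: "nat \<Rightarrow> real^'d" and b :: "nat \<Rightarrow> real"
    where h: "\<And>z. h z = z + (\<Sum>j<m. ReLU (B j \<bullet> z + b j) *\<^sub>R A j)"
    using assms unfolding relu_sylvester_flow_def by blast
  have det: "AE x in lborel. det (jacobian h (at x)) \<noteq> 0"
    using assms by (simp add: relu_sylvester_flow_def normalizing_flow_def)
  have "AE x in lborel. B j \<noteq> 0 \<longrightarrow> B j \<bullet> x + b j \<noteq> 0" for j
  proof (cases "B j = 0")
    case False
    then have "negligible {x. B j \<bullet> x = - b j}" by (intro negligible_hyperplane) auto
    then show ?thesis
      using False by (simp add: AE_lborel_iff_negligible eq_neg_iff_add_eq_0)
  qed auto
  then have "AE x in lborel. \<forall>j\<in>{..<m}. B j \<noteq> 0 \<longrightarrow> B j \<bullet> x + b j \<noteq> 0"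
    by (intro AE_finite_allI) auto
  with det show ?thesis
  proof eventually_elim
    case (elim x)
    \<comment> \<open>The units active at \<open>x\<close> keep their affine form nearby and the
      others vanish; \<open>l\<close> and \<open>c\<close> are the resulting linear and constant
      parts.\<close>
    define l where "l z = z + (\<Sum>j<m. (if B j \<bullet> x + b j > 0 then B j \<bullet> z else 0) *\<^sub>R A j)" for z
    define c where "c = (\<Sum>j<m. (if B j \<bullet> x + b j > 0 then b j else 0) *\<^sub>R A j)"
    have "linear l"
      by (rule linearI)
        (auto simp: l_def inner_add_right scaleR_add_left scaleR_add_right scaleR_sum_right
          sum.distrib[symmetric] intro!: sum.cong)
    then have l: "l z = matrix l *v z" for z by (simp add: matrix_works)
    have "\<forall>\<^sub>F z in nhds x. \<forall>j\<in>{..<m}. ReLU (B j \<bullet> z + b j) =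
            (if B j \<bullet> x + b j > 0 then B j \<bullet> z + b j else 0)"
      using elim by (intro eventually_ball_finite ballI eventually_ReLU_affine) auto
    then have aff: "\<forall>\<^sub>F z in nhds x. h z = matrix l *v z + c"
    proof eventually_elim
      case (elim z)
      have "h z = l z + c"
        unfolding h l_def c_def add.assoc sum.distrib[symmetric]
        using elim by (auto simp: scaleR_add_left intro!: sum.cong)
      then show ?case using l by simp
    qed
    \<comment> \<open>The Jacobian at \<open>x\<close> is \<open>matrix l\<close>, so the flow
      condition on Jacobians supplies invertibility.\<close>
    with elim show ?case
      unfolding locally_invertible_affine_def
      using jacobian_eventually_affine by metis
  qed
qed

lemma foldr_relu_sylvester_flows:
  assumes "\<And>h. h \<in> set fs \<Longrightarrow> relu_sylvester_flow h"
  shows "bij (foldr (\<circ>) fs id) \<and> (AE x in lborel. locally_invertible_affine (foldr (\<circ>) fs id) x)"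
  using assms
proof (induction fs)
  case Nil
  have "locally_invertible_affine id x" for x :: "real^'a"
    unfolding locally_invertible_affine_def
    by (rule exI[of _ "mat 1"], rule exI[of _ 0]) simp
  then show ?case by (simp flip: id_def)
next
  case (Cons h fs)
  let ?F = "foldr (\<circ>) fs id"
  have "bij ?F \<and> (AE x in lborel. locally_invertible_affine ?F x)"
    by (rule Cons.IH) (simp add: Cons.prems)
  then have F: "bij ?F" "AE x in lborel. locally_invertible_affine ?F x"
    by blast+
  have h: "bij h" "AE x in lborel. locally_invertible_affine h x"
    by (simp_all add: Cons.prems relu_sylvester_flow_bij
      relu_sylvester_flow_AE_locally_invertible_affine)
  \<comment> \<open>The outer layer \<open>h\<close> is evaluated at \<open>?F x\<close>, so its
    exceptional null set has to be pulled back along \<open>?F\<close>.\<close>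
  have "AE x in lborel. locally_invertible_affine h (?F x)"
    using AE_compose_locally_invertible_affine F(2) h(2) by blast
  with F(2) have "AE x in lborel. locally_invertible_affine (h \<circ> ?F) x"
    by eventually_elim (rule locally_invertible_affine_compose)
  moreover have "foldr (\<circ>) (h # fs) id = h \<circ> ?F" by simp
  ultimately show ?case using bij_comp[OF F(1) h(1)] by (simp only: simp_thms)
qed

section \<open>Log-densities and the comparison of their gradients\<close>

lemma has_derivative_sum_ln:
  fixes z :: "real^'d"
  assumes "smooth g" "\<And>t. g t > 0"
  shows "((\<lambda>z. \<Sum>i\<in>UNIV. ln (g (z $ i))) has_derivative (\<lambda>v. tilde_nabla_log g z \<bullet> v)) (at z)"
proof -
  have "g differentiable (at t)" for t
    using assms(1) unfolding smooth_def by (metis funpow_0)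
  then have "((\<lambda>t. ln (g t)) has_derivative (*) (deriv (\<lambda>t. ln (g t)) t)) (at t)" for t
    unfolding has_field_derivative_def[symmetric] DERIV_deriv_iff_real_differentiable
    using DERIV_chain2[where f = ln and g = g, OF DERIV_ln[OF assms(2)[of t]]]
    unfolding real_differentiable_def by blast
  \<comment> \<open>Each summand depends on one coordinate only, so the ordinary gradient of the sum
    is \<open>tilde_nabla_log g\<close>.\<close>
  from has_derivative_compose[OF bounded_linear_imp_has_derivative[OF bounded_linear_vec_nth] this]
  have "((\<lambda>z. ln (g (z $ i))) has_derivative (\<lambda>v. deriv (\<lambda>t. ln (g t)) (z $ i) * v $ i)) (at z)"
    for i :: 'd .
  then show ?thesis
    unfolding tilde_nabla_log_def tilde_nabla_def inner_vec_def
    by (simp add: has_derivative_sum)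
qed

theorem corollaryA5p2:
  fixes g :: "real \<Rightarrow> real" and r_p r_q :: real
    and p q :: "real^'d \<Rightarrow> real"
    and f :: "real^'d \<Rightarrow> real^'d" and fs :: "(real^'d \<Rightarrow> real^'d) list"
  assumes "CARD('d) > 1"
    and "smooth g" and "\<And>t. g t > 0"
    and "r_p > 0" and "r_q > 0" and "r_p \<noteq> r_q"
    and "product_power_density g r_p p"
    and "product_power_density g r_q q"
    and "\<And>h. h \<in> set fs \<Longrightarrow> relu_sylvester_flow h"
    and "f = foldr (\<circ>) fs id"
    and "AE y in lborel. p y = pushforward_density f q y"
  shows "AE x in lborel. \<exists>\<Gamma>. open \<Gamma> \<and> x \<in> \<Gamma> \<and>
           (\<exists>(A :: real^'d^'d) (b :: real^'d). \<forall>z\<in>\<Gamma>.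
              r_q *\<^sub>R tilde_nabla_log g z =
              r_p *\<^sub>R (transpose A *v tilde_nabla_log g (A *v z + b)))"
proof -
  have "bij f" and f: "AE x in lborel. locally_invertible_affine f x"
    using foldr_relu_sylvester_flows assms(9,10) by auto
  define L where "L = (\<lambda>z::real^'d. \<Sum>i\<in>UNIV. ln (g (z $ i)))"
  have dL: "(L has_derivative (\<lambda>v. tilde_nabla_log g z \<bullet> v)) (at z)" for z
    unfolding L_def by (rule has_derivative_sum_ln) (fact assms)+
  have dens: "\<exists>c>0. AE z in lborel. s z = c * exp (r * L z)"
    if "product_power_density g r s" for r and s :: "real^'d \<Rightarrow> real"
  proof -
    \<comment> \<open>Positivity of \<open>g\<close> excludes the special value of
      \<open>powr\<close> at base 0, so each factor is an exponential.\<close>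
    have "(\<Prod>i\<in>UNIV. g (z $ i) powr r) = exp (r * L z)" for z
      using assms(3) by (simp add: L_def powr_def exp_sum sum_distrib_left less_imp_neq[symmetric])
    with that show ?thesis by (simp add: product_power_density_def)
  qed
  obtain cp where cp: "cp > 0" "AE z in lborel. p z = cp * exp (r_p * L z)"
    using dens[OF assms(7)] by blast
  obtain cq where cq: "cq > 0" "AE z in lborel. q z = cq * exp (r_q * L z)"
    using dens[OF assms(8)] by blast
  \<comment> \<open>The hypothesis on \<open>p\<close> is read at \<open>y = f x\<close>, where
    \<open>inv f y = x\<close>; pulling back along \<open>f\<close> keeps the exceptional set
    null.\<close>
  have "AE x in lborel. p (f x) = q x / \<bar>det (jacobian f (at x))\<bar>"
    using AE_compose_locally_invertible_affine[OF f assms(11)] \<open>bij f\<close>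
    by (simp add: pushforward_density_def bij_is_inj)
  with cq(2) AE_compose_locally_invertible_affine[OF f cp(2)]
  have eq: "AE x in lborel. cp * exp (r_p * L (f x)) =
      cq * exp (r_q * L x) / \<bar>det (jacobian f (at x))\<bar>"
    by eventually_elim simp
  from f show ?thesis
  proof eventually_elim
    case (elim x)
    obtain A b where "det A \<noteq> 0" and ev: "\<forall>\<^sub>F z in nhds x. f z = A *v z + b"
      using elim unfolding locally_invertible_affine_def by auto
    obtain G where G: "open G" "x \<in> G" "\<And>z. z \<in> G \<Longrightarrow> f z = A *v z + b"
      using ev unfolding eventually_nhds by blast
    have J: "jacobian f (at z) = A" if "z \<in> G" for z
      using G that by (intro jacobian_eventually_affine) (auto simp: eventually_nhds)
    \<comment> \<open>The Jacobian is \<open>A\<close> throughout \<open>G\<close>, so taking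
      logarithms leaves one constant \<open>k\<close>, made of the two normalizing constants and the
      determinant.\<close>
    define k where "k = ln (cq / \<bar>det A\<bar>) - ln cp"
    have dLA: "((\<lambda>z. L (A *v z + b)) has_derivative
        (\<lambda>v. (transpose A *v tilde_nabla_log g (A *v z + b)) \<bullet> v)) (at z)" for z
    proof -
      \<comment> \<open>The chain rule pairs the gradient at \<open>A *v z + b\<close> with
        \<open>A *v v\<close>; the adjoint identity moves \<open>A\<close> across as its
        transpose.\<close>
      from has_derivative_compose[OF has_derivative_affine dL] show ?thesis
        by (simp add: dot_lmul_matrix)
    qed
    have "AE z in lborel. z \<in> G \<longrightarrow> r_p * L (A *v z + b) = r_q * L z + k"
      using eq
    proof eventually_elim
      case (elim z)
      show ?case
      proof
        assume "z \<in> G"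
        then have "cp * exp (r_p * L (A *v z + b)) = cq / \<bar>det A\<bar> * exp (r_q * L z)"
          using elim G(3) J by simp
        then have "ln (cp * exp (r_p * L (A *v z + b))) = ln (cq / \<bar>det A\<bar> * exp (r_q * L z))"
          by simp
        then show "r_p * L (A *v z + b) = r_q * L z + k"
          using cp(1) cq(1) \<open>det A \<noteq> 0\<close> by (simp add: k_def ln_mult ln_div)
      qed
    qed
    moreover have "continuous_on G L" "continuous_on G (\<lambda>z. L (A *v z + b))"
      by (rule dL dLA has_derivative_at_withinI has_derivative_continuous_on)+
    ultimately have LG: "r_p * L (A *v z + b) = r_q * L z + k" if "z \<in> G" for z
      using that \<open>open G\<close>
      by (intro continuous_on_AE_eq[where S = G and x = z
            and u = "\<lambda>z. r_p * L (A *v z + b)" and v = "\<lambda>z. r_q * L z + k"])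
        (auto intro!: continuous_intros)
    have "r_q *\<^sub>R tilde_nabla_log g z = r_p *\<^sub>R (transpose A *v tilde_nabla_log g (A *v z + b))"
      if "z \<in> G" for z
    proof -
      have "((\<lambda>z. r_q * L z + k) has_derivative (\<lambda>v. r_q * (tilde_nabla_log g z \<bullet> v))) (at z)"
        by (intro has_derivative_add_const has_derivative_mult_right dL)
      \<comment> \<open>By \<open>LG\<close> both sides are the same function near \<open>z\<close>,
        so it has two expressions for its derivative; uniqueness equates them, and testing against
        all \<open>v\<close> gives equal vectors.\<close>
      moreover have "((\<lambda>z. r_q * L z + k) has_derivative
          (\<lambda>v. r_p * ((transpose A *v tilde_nabla_log g (A *v z + b)) \<bullet> v))) (at z)"
        by (rule has_derivative_transform_within_open[OF has_derivative_mult_right[OF dLA]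
              \<open>open G\<close> \<open>z \<in> G\<close> LG])
      ultimately have "(\<lambda>v. r_q * (tilde_nabla_log g z \<bullet> v)) =
          (\<lambda>v. r_p * ((transpose A *v tilde_nabla_log g (A *v z + b)) \<bullet> v))"
        by (rule has_derivative_unique)
      then have "\<forall>v. (r_q *\<^sub>R tilde_nabla_log g z) \<bullet> v =
          (r_p *\<^sub>R (transpose A *v tilde_nabla_log g (A *v z + b))) \<bullet> v"
        by (simp add: fun_eq_iff)
      then show ?thesis by (simp only: vector_eq_rdot)
    qed
    with G show ?case by blast
  qed
qed

end
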